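(* Let $\mathbb S$ and $\mathbb T$ be consistent algebraic theories. Suppose $\mathbb S$ satisfies: (1) $\mathbb S$ has a constant $e_{\mathbb S}$; (2) $\mathbb S$ has a term $s$ with at least two variables such that $e_{\mathbb S}$ is a unit of $s$: for every $x\in\mathrm{var}(s)$, $s[e_{\mathbb S}/y\neq x]=_{\mathbb S}x$; (3) $\mathbb S$ satisfies an equation $X\vdash s'=_{\mathbb S}e_{\mathbb S}$ with $\mathrm{var}(s')\neq\emptyset$, where $s'$ can be written as $s''[s_i/x_i]$ for some term $s''$ and terms $s_i$, such that $\mathrm{var}(s'')\cap\mathrm{var}(s')\neq\emptyset$ and there is a substitution $f$ from $\mathrm{var}(s'')$ to $\mathbb S$-terms with $\Gamma\vdash s''[f(y)/y\neq x]=_{\mathbb S}x$ for every $x\in\mathrm{var}(s'')$. Suppose $\mathbb T$ satisfies: (1) $\mathbb T$ has a constant $e_{\mathbb T}$; (2) for all terms $X\vdash t'$ and every variable substitution $g:X\to Y$: if $Y\vdash t'[g]=_{\mathbb T}e_{\mathbb T}$ then $X\vdash t'=_{\mathbb T}e_{\mathbb T}$. Then there does not exist a composite theory of $\mathbb T$ after $\mathbb S$.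
   Context: An algebraic theory consists of a signature and equations; $=_{\mathbb T}$ is provable equality. A theory is consistent if it does not prove $x=y$ for distinct variables. $\mathrm{var}(t)$ is the set of variables of $t$; $Y\vdash t$ means $\mathrm{var}(t)\subseteq Y$; $\Gamma$ is an arbitrary context; a constant is a $0$-ary operation. $u[v/y\neq x]$ substitutes $v$ for every variable $y\neq x$ of $u$; $s''[s_i/x_i]$ is simultaneous substitution (syntactic); $t'[g]$ renames variables by $g$. For theories $\mathbb{S},\mathbb{T}$: $\mathbb{U}$ contains them if its signature contains both signatures and their equations are provable in $\mathbb{U}$; a separated term is $t[s_x/x]$ with $t$ a $\mathbb{T}$-term with variables in $X$ and $s_x$ $\mathbb{S}$-terms; separated terms $t[s_x/x]$, $t'[s'_{x'}/x']$ are equal modulo $(\mathbb{T},\mathbb{S})$ if there are $f:X\to Y$, $f':X'\to Y$ and $\mathbb{S}$-terms $\bar s_y$ with $t[f(x)/x]=_{\mathbb T}t'[f'(x')/x']$, $s_x=_{\mathbb S}\bar s_{f(x)}$, $s'_{x'}=_{\mathbb S}\bar s_{f'(x')}$; $\mathbb{U}$ is a composite theory of $\mathbb{T}$ after $\mathbb{S}$ if every $\mathbb U$-term is $\mathbb U$-equal to a separated term and any two separated terms $\mathbb U$-equal to a common term are equal modulo $(\mathbb{T},\mathbb{S})$.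
   Formalization: In S(3), some variable common to s'' and s' must be left in place (not one of the replaced x_i), and for distinct x, y in var(s'') the variable x must not occur in f(y); without either condition the statement is false. *)

theory Defs
  imports Main "HOL-Library.FuncSet"
begin

section \<open>Terms and algebraic theories\<close>

datatype (ops_of: 'f, vars: 'v) trm = Var 'v | Op 'f "('f, 'v) trm list"

primrec subst :: "('f, 'v) trm \<Rightarrow> ('v \<Rightarrow> ('f, 'v) trm) \<Rightarrow> ('f, 'v) trm" where
  "subst (Var x) \<sigma> = \<sigma> x"
| "subst (Op f ts) \<sigma> = Op f (map (\<lambda>t. subst t \<sigma>) ts)"

abbreviation const :: "'f \<Rightarrow> ('f, 'v) trm" where
  "const c \<equiv> Op c []"

definition rename :: "('f, 'v) trm \<Rightarrow> ('v \<Rightarrow> 'v) \<Rightarrow> ('f, 'v) trm" where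
  "rename t g = subst t (\<lambda>x. Var (g x))"

text \<open>\<open>subst_except u x \<sigma>\<close> is \<open>u[\<sigma>(y) / y \<noteq> x]\<close>: every variable other than \<open>x\<close> is substituted.\<close>

definition subst_except :: "('f, 'v) trm \<Rightarrow> 'v \<Rightarrow> ('v \<Rightarrow> ('f, 'v) trm) \<Rightarrow> ('f, 'v) trm" where
  "subst_except u x \<sigma> = subst u (\<lambda>y. if y = x then Var x else \<sigma> y)"

text \<open>\<open>subst_on u I \<sigma>\<close> is the simultaneous substitution \<open>u[\<sigma>(i) / i]\<close> with \<open>i\<close> ranging over the
  variables in \<open>I\<close>; variables outside \<open>I\<close> stay as they are.\<close>

definition subst_on :: "('f, 'v) trm \<Rightarrow> 'v set \<Rightarrow> ('v \<Rightarrow> ('f, 'v) trm) \<Rightarrow> ('f, 'v) trm" where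
  "subst_on u I \<sigma> = subst u (\<lambda>y. if y \<in> I then \<sigma> y else Var y)"

text \<open>Operation symbols of different theories come from one common type, so that one signature
  can literally contain another. The values of \<open>arity\<close> outside \<open>ops\<close> are irrelevant.\<close>

record ('f, 'v) alg_theory =
  ops :: "'f set"
  arity :: "'f \<Rightarrow> nat"
  eqs :: "(('f, 'v) trm \<times> ('f, 'v) trm) set"

fun term_of :: "('f, 'v) alg_theory \<Rightarrow> ('f, 'v) trm \<Rightarrow> bool" where
  "term_of T (Var x) \<longleftrightarrow> True"
| "term_of T (Op f ts) \<longleftrightarrow> f \<in> ops T \<and> length ts = arity T f \<and> (\<forall>t\<in>set ts. term_of T t)"

definition algebraic_theory :: "('f, 'v) alg_theory \<Rightarrow> bool" where
  "algebraic_theory T \<longleftrightarrow> (\<forall>(l, r)\<in>eqs T. term_of T l \<and> term_of T r)"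

definition has_constant :: "('f, 'v) alg_theory \<Rightarrow> 'f \<Rightarrow> bool" where
  "has_constant T c \<longleftrightarrow> c \<in> ops T \<and> arity T c = 0"

inductive provable :: "('f, 'v) alg_theory \<Rightarrow> ('f, 'v) trm \<Rightarrow> ('f, 'v) trm \<Rightarrow> bool"
  for T where
  ax: "(l, r) \<in> eqs T \<Longrightarrow> (\<And>x. x \<in> vars l \<union> vars r \<Longrightarrow> term_of T (\<sigma> x))
        \<Longrightarrow> provable T (subst l \<sigma>) (subst r \<sigma>)"
| refl: "term_of T t \<Longrightarrow> provable T t t"
| sym: "provable T s t \<Longrightarrow> provable T t s"
| trans: "provable T s t \<Longrightarrow> provable T t u \<Longrightarrow> provable T s u"
| cong: "f \<in> ops T \<Longrightarrow> length ss = arity T f \<Longrightarrow> list_all2 (provable T) ss ts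
        \<Longrightarrow> provable T (Op f ss) (Op f ts)"

text \<open>Equality in a context, \<open>X \<turnstile> s =\<^sub>T t\<close>. The context bounds the variables of the two sides only,
  not those of intermediate steps of a derivation; as soon as the theory has a constant,
  superfluous variables in a derivation can be replaced by it, so this makes no difference.\<close>

definition provable_in ::
  "('f, 'v) alg_theory \<Rightarrow> 'v set \<Rightarrow> ('f, 'v) trm \<Rightarrow> ('f, 'v) trm \<Rightarrow> bool" where
  "provable_in T X s t \<longleftrightarrow> vars s \<subseteq> X \<and> vars t \<subseteq> X \<and> provable T s t"

definition consistent :: "('f, 'v) alg_theory \<Rightarrow> bool" where
  "consistent T \<longleftrightarrow> \<not> (\<exists>x y. x \<noteq> y \<and> provable T (Var x) (Var y))"

section \<open>Composite theories\<close>

definition contains_theory :: "('f, 'v) alg_theory \<Rightarrow> ('f, 'v) alg_theory \<Rightarrow> bool" where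
  "contains_theory U S \<longleftrightarrow>
     ops S \<subseteq> ops U \<and> (\<forall>f\<in>ops S. arity S f = arity U f) \<and>
     (\<forall>(l, r)\<in>eqs S. provable U l r)"

text \<open>\<open>separated T S X t s\<close> says that \<open>X\<close>, \<open>t\<close>, \<open>s\<close> are the data of a separated term; the term
  itself is \<open>subst t s\<close>. Equality modulo \<open>(T, S)\<close> is a relation between such data.\<close>

definition separated ::
  "('f, 'v) alg_theory \<Rightarrow> ('f, 'v) alg_theory \<Rightarrow>
   'v set \<Rightarrow> ('f, 'v) trm \<Rightarrow> ('v \<Rightarrow> ('f, 'v) trm) \<Rightarrow> bool" where
  "separated T S X t s \<longleftrightarrow> term_of T t \<and> vars t \<subseteq> X \<and> (\<forall>x\<in>X. term_of S (s x))"

definition equal_modulo ::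
  "('f, 'v) alg_theory \<Rightarrow> ('f, 'v) alg_theory \<Rightarrow>
   'v set \<Rightarrow> ('f, 'v) trm \<Rightarrow> ('v \<Rightarrow> ('f, 'v) trm) \<Rightarrow>
   'v set \<Rightarrow> ('f, 'v) trm \<Rightarrow> ('v \<Rightarrow> ('f, 'v) trm) \<Rightarrow> bool" where
  "equal_modulo T S X t s X' t' s' \<longleftrightarrow>
     (\<exists>Y f f' r. f \<in> X \<rightarrow> Y \<and> f' \<in> X' \<rightarrow> Y \<and> (\<forall>y\<in>Y. term_of S (r y)) \<and>
        provable T (rename t f) (rename t' f') \<and>
        (\<forall>x\<in>X. provable S (s x) (r (f x))) \<and>
        (\<forall>x'\<in>X'. provable S (s' x') (r (f' x'))))"

definition composite_theory ::
  "('f, 'v) alg_theory \<Rightarrow> ('f, 'v) alg_theory \<Rightarrow> ('f, 'v) alg_theory \<Rightarrow> bool" where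
  "composite_theory U T S \<longleftrightarrow>
     algebraic_theory U \<and> contains_theory U S \<and> contains_theory U T \<and>
     (\<forall>u. term_of U u \<longrightarrow> (\<exists>X t s. separated T S X t s \<and> provable U u (subst t s))) \<and>
     (\<forall>u X t s X' t' s'. term_of U u \<longrightarrow> separated T S X t s \<longrightarrow> separated T S X' t' s' \<longrightarrow>
        provable U (subst t s) u \<longrightarrow> provable U (subst t' s') u \<longrightarrow>
        equal_modulo T S X t s X' t' s')"

end

theory Submission
  imports Defs
begin

text \<open>In a composite theory \<open>U\<close>, a term \<open>u\<close> with \<open>u[\<tau>] =\<^sub>U e\<^sub>T\<close> for some \<open>S\<close>-substitution \<open>\<tau>\<close>
  already satisfies \<open>u =\<^sub>U e\<^sub>T\<close>: separate \<open>u\<close> as \<open>t[s\<^sub>x/x]\<close>; then \<open>t[s\<^sub>x[\<tau>]/x]\<close> is separated and equal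
  to \<open>e\<^sub>T\<close>, so some renaming of \<open>t\<close> is \<open>T\<close>-equal to \<open>e\<^sub>T\<close>, hence so is \<open>t\<close> itself.
  For \<open>u = s''[e\<^sub>T/x]\<close> and \<open>\<tau> = f\<close> this gives \<open>s''[e\<^sub>T/x] =\<^sub>U e\<^sub>T\<close>, and substituting the terms
  \<open>\<sigma> i\<close> turns it into \<open>s'[e\<^sub>T/x] =\<^sub>U e\<^sub>T\<close>. But \<open>s' =\<^sub>S e\<^sub>S\<close>, so \<open>e\<^sub>S =\<^sub>U e\<^sub>T\<close>; comparing these as
  separated terms gives \<open>z =\<^sub>T e\<^sub>T\<close> for a variable \<open>z\<close>, contradicting consistency.\<close>

lemma subst_subst: "subst (subst t \<sigma>) \<tau> = subst t (\<lambda>x. subst (\<sigma> x) \<tau>)"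
  by (induction t) auto

lemma subst_cong:
  assumes "\<And>x. x \<in> vars t \<Longrightarrow> \<sigma> x = \<tau> x"
  shows "subst t \<sigma> = subst t \<tau>"
  using assms by (induction t) auto

lemma subst_Var: "subst t Var = t"
  by (induction t) (auto simp: map_idI)

lemma vars_subst: "vars (subst t \<sigma>) = (\<Union>x\<in>vars t. vars (\<sigma> x))"
  by (induction t) auto

lemma term_of_subst:
  assumes "term_of T t" "\<And>x. x \<in> vars t \<Longrightarrow> term_of T (\<sigma> x)"
  shows "term_of T (subst t \<sigma>)"
  using assms by (induction t) auto

lemma term_of_const: "has_constant T c \<Longrightarrow> term_of T (const c)"
  by (simp add: has_constant_def)

text \<open>Intermediate terms of a derivation may have further variables, so \<open>\<tau>\<close> has to yield
  terms of \<open>T\<close> on all variables, not only on those of \<open>s\<close> and \<open>t\<close>.\<close>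

lemma provable_subst:
  assumes "provable T s t" "\<And>x. term_of T (\<tau> x)"
  shows "provable T (subst s \<tau>) (subst t \<tau>)"
  using assms(1)
proof (induction rule: provable.induct)
  case (ax l r \<sigma>)
  have "provable T (subst l (\<lambda>x. subst (\<sigma> x) \<tau>)) (subst r (\<lambda>x. subst (\<sigma> x) \<tau>))"
    using ax assms(2) by (intro provable.ax) (auto intro: term_of_subst)
  then show ?case by (simp add: subst_subst)
next
  case (cong f ss ts)
  then show ?case
    by (auto intro!: provable.cong simp: list_all2_conv_all_nth)
qed (auto intro: provable.intros term_of_subst assms(2))

lemma term_of_contains:
  assumes "contains_theory U S" "term_of S t"
  shows "term_of U t"
  using assms(2) by (induction t) (use assms(1) in \<open>auto simp: contains_theory_def\<close>)

lemma provable_contains: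
  assumes "contains_theory U S" "provable S s t"
  shows "provable U s t"
  using assms(2)
proof (induction rule: provable.induct)
  case (ax l r \<sigma>)
  \<comment> \<open>\<open>\<sigma>\<close> is controlled only on the variables of the axiom, while
    \<open>provable_subst\<close> wants a term of \<open>U\<close> at every variable.\<close>
  define \<tau> where "\<tau> x = (if x \<in> vars l \<union> vars r then \<sigma> x else Var x)" for x
  have "subst l \<sigma> = subst l \<tau>" "subst r \<sigma> = subst r \<tau>"
    by (auto simp: \<tau>_def intro: subst_cong)
  moreover have "provable U (subst l \<tau>) (subst r \<tau>)"
    using ax assms(1) term_of_contains[OF assms(1)]
    by (intro provable_subst) (auto simp: \<tau>_def contains_theory_def)
  ultimately show ?case by simp
next
  case (cong f ss ts)
  then show ?case using assms(1)
    by (intro provable.cong) (auto simp: contains_theory_def list_all2_conv_all_nth)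
qed (auto intro: provable.intros term_of_contains[OF assms(1)])

lemma composite_reflects_constant:
  assumes comp: "composite_theory U T S"
    and eT: "has_constant T eT"
    and reflect: "\<And>X Y t' g. term_of T t' \<Longrightarrow> vars t' \<subseteq> X \<Longrightarrow> g \<in> X \<rightarrow> Y \<Longrightarrow>
               provable_in T Y (rename t' g) (const eT) \<Longrightarrow> provable_in T X t' (const eT)"
    and u: "term_of U u"
    and \<tau>: "\<And>x. term_of S (\<tau> x)"
    and eq: "provable U (subst u \<tau>) (const eT)"
  shows "provable U u (const eT)"
proof -
  have cS: "contains_theory U S" and cT: "contains_theory U T"
    using comp by (auto simp: composite_theory_def)
  obtain X t s0 where "separated T S X t s0" "provable U u (subst t s0)"
    using comp u unfolding composite_theory_def by blast
  \<comment> \<open>Off \<open>X\<close> the values of \<open>s0\<close> are arbitrary; with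
    variables there, \<open>s\<close> can be used in \<open>provable_subst\<close> at the
    end.\<close>
  moreover define s where "s x = (if x \<in> X then s0 x else Var x)" for x
  moreover have "subst t s0 = subst t s" if "vars t \<subseteq> X"
    using that by (intro subst_cong) (auto simp: s_def)
  ultimately have sep: "term_of T t" "vars t \<subseteq> X" "\<And>x. term_of S (s x)"
    and us: "provable U u (subst t s)"
    by (auto simp: separated_def)
  have "provable U (subst u \<tau>) (subst t (\<lambda>x. subst (s x) \<tau>))"
    using provable_subst[OF us, of \<tau>] \<tau> by (simp add: subst_subst term_of_contains[OF cS])
  then have "provable U (subst t (\<lambda>x. subst (s x) \<tau>)) (const eT)"
    using eq by (blast intro: provable.intros)
  moreover have "separated T S X t (\<lambda>x. subst (s x) \<tau>)"
    using sep \<tau> by (auto simp: separated_def intro: term_of_subst)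
  \<comment> \<open>A constant has no variables, so the empty context suffices and renaming leaves
    it unchanged.\<close>
  moreover have "separated T S {} (const eT) Var"
    using term_of_const[OF eT] by (simp add: separated_def)
  moreover have cU: "term_of U (const eT)"
    using term_of_contains[OF cT] term_of_const[OF eT] .
  moreover from cU have "provable U (subst (const eT) Var) (const eT)"
    by (simp add: provable.refl)
  ultimately have "equal_modulo T S X t (\<lambda>x. subst (s x) \<tau>) {} (const eT) Var"
    using comp unfolding composite_theory_def by blast
  then obtain Y g where g: "g \<in> X \<rightarrow> Y" and eqT: "provable T (rename t g) (const eT)"
    by (auto simp: equal_modulo_def rename_def)
  have "vars (rename t g) \<subseteq> Y"
    using g sep(2) by (auto simp: rename_def vars_subst)
  then have "provable_in T Y (rename t g) (const eT)"
    using eqT by (simp add: provable_in_def)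
  then have "provable T t (const eT)"
    using reflect[OF sep(1,2) g] by (simp add: provable_in_def)
  from provable_subst[OF provable_contains[OF cT this], of s]
  have "provable U (subst t s) (const eT)"
    by (simp add: term_of_contains[OF cS] sep(3))
  with us show ?thesis by (rule provable.trans)
qed

lemma composite_constants_distinct:
  fixes T :: "('f, 'v) alg_theory"
  assumes comp: "composite_theory U T S"
    and inf_vars: "infinite (UNIV :: 'v set)"
    and "consistent T" "has_constant S eS" "has_constant T eT"
  shows "\<not> provable U (const eS) (const eT)"
proof
  assume eq: "provable U (const eS) (const eT)"
  obtain a b :: 'v where ab: "a \<noteq> b"
    using inf_vars by (metis ex_new_if_finite finite.emptyI finite_insert insertI1)
  \<comment> \<open>Here \<open>eS\<close> is a bare variable of \<open>T\<close> carrying an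
    \<open>S\<close>-term and \<open>eT\<close> is a \<open>T\<close>-term carrying none, so their
    \<open>T\<close>-parts are a variable and a constant.\<close>
  have "separated T S {a} (Var a) (\<lambda>_. const eS)" "separated T S {} (const eT) Var"
    using assms by (simp_all add: separated_def has_constant_def)
  moreover have cU: "term_of U (const eT)"
    using comp assms(5) by (auto simp: composite_theory_def contains_theory_def has_constant_def)
  moreover have "provable U (subst (Var a) (\<lambda>_. const eS)) (const eT)"
    using eq by simp
  moreover have "provable U (subst (const eT) Var) (const eT)"
    using cU by (simp add: provable.refl)
  ultimately have "equal_modulo T S {a} (Var a) (\<lambda>_. const eS) {} (const eT) Var"
    using comp unfolding composite_theory_def by blast
  then obtain z where "provable T (Var z) (const eT)"
    by (auto simp: equal_modulo_def rename_def)
  \<comment> \<open>\<open>eT\<close> is closed, so \<open>z\<close> can be replaced by any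
    variable.\<close>
  from provable_subst[OF this, of "\<lambda>_. Var _"] have "provable T (Var x) (const eT)" for x
    by simp
  then have "provable T (Var a) (Var b)"
    by (blast intro: provable.intros)
  with ab \<open>consistent T\<close> show False
    by (auto simp: consistent_def)
qed

theorem theorem5p2:
  fixes S T :: "('f, 'v) alg_theory"
    and eS eT :: 'f
    and s s' s'' :: "('f, 'v) trm"
    and X I \<Gamma> :: "'v set"
    and \<sigma> f :: "'v \<Rightarrow> ('f, 'v) trm"
  assumes inf_vars: "infinite (UNIV :: 'v set)"
    and theories: "algebraic_theory S" "algebraic_theory T"
    and consistent: "consistent S" "consistent T"
    and S1: "has_constant S eS"
    and S2_term: "term_of S s" "2 \<le> card (vars s)"
    and S2_unit: "\<And>x. x \<in> vars s \<Longrightarrow> provable S (subst_except s x (\<lambda>_. const eS)) (Var x)"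
    and S3_eq: "provable_in S X s' (const eS)" "vars s' \<noteq> {}"
    and S3_decomp: "term_of S s''" "\<And>i. i \<in> I \<Longrightarrow> term_of S (\<sigma> i)" "s' = subst_on s'' I \<sigma>"
    and S3_common: "(vars s'' \<inter> vars s') - I \<noteq> {}"
    and S3_f: "\<And>y. y \<in> vars s'' \<Longrightarrow> term_of S (f y)"
    and S3_f_fresh: "\<And>x y. x \<in> vars s'' \<Longrightarrow> y \<in> vars s'' \<Longrightarrow> y \<noteq> x \<Longrightarrow> x \<notin> vars (f y)"
    and S3_f_eq: "\<And>x. x \<in> vars s'' \<Longrightarrow> provable_in S \<Gamma> (subst_except s'' x f) (Var x)"
    and T1: "has_constant T eT"
    and T2: "\<And>X Y t' g. term_of T t' \<Longrightarrow> vars t' \<subseteq> X \<Longrightarrow> g \<in> X \<rightarrow> Y \<Longrightarrow>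
               provable_in T Y (rename t' g) (const eT) \<Longrightarrow> provable_in T X t' (const eT)"
  shows "\<not> (\<exists>U :: ('f, 'v) alg_theory. composite_theory U T S)"
proof
  assume "\<exists>U :: ('f, 'v) alg_theory. composite_theory U T S"
  then obtain U :: "('f, 'v) alg_theory" where comp: "composite_theory U T S" by blast
  then have cS: "contains_theory U S" and cT: "contains_theory U T"
    by (auto simp: composite_theory_def)
  have eTU: "term_of U (const eT)"
    using term_of_contains[OF cT] term_of_const[OF T1] .
  \<comment> \<open>Outside \<open>I\<close> the passage from \<open>s''\<close> to
    \<open>s'\<close> changes nothing, so \<open>eT\<close> put for \<open>x\<close> survives
    it.\<close>
  obtain x where x: "x \<in> vars s''" "x \<notin> I"
    using S3_common by blast
  define \<kappa> where "\<kappa> = Var(x := const eT)"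
  have \<kappa>: "term_of U (\<kappa> y)" for y
    using eTU by (simp add: \<kappa>_def)
  \<comment> \<open>\<open>x\<close> no longer occurs in \<open>subst s'' \<kappa>\<close>; the
    default only ensures an \<open>S\<close>-term at every variable.\<close>
  define \<tau> where "\<tau> y = (if y \<in> vars s'' \<and> y \<noteq> x then f y else Var y)" for y
  have u: "term_of U (subst s'' \<kappa>)"
    using S3_decomp(1) \<kappa> by (blast intro: term_of_subst term_of_contains[OF cS])
  \<comment> \<open>By freshness \<open>x\<close> is not in \<open>f y\<close>, so putting
    \<open>eT\<close> for \<open>x\<close> before or after applying \<open>f\<close> gives the same
    term.\<close>
  have f_\<kappa>: "subst (f y) \<kappa> = f y" if "y \<in> vars s''" "y \<noteq> x" for y
  proof -
    have "subst (f y) \<kappa> = subst (f y) Var"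
      using S3_f_fresh[OF x(1) that] by (intro subst_cong) (auto simp: \<kappa>_def)
    then show ?thesis by (simp add: subst_Var)
  qed
  have "subst (subst s'' \<kappa>) \<tau> = subst (subst_except s'' x f) \<kappa>"
    unfolding subst_except_def subst_subst
    by (intro subst_cong) (auto simp: f_\<kappa>, auto simp: \<kappa>_def \<tau>_def)
  moreover have "provable U (subst (subst_except s'' x f) \<kappa>) (subst (Var x) \<kappa>)"
    using S3_f_eq[OF x(1)] \<kappa>
    by (intro provable_subst provable_contains[OF cS]) (auto simp: provable_in_def)
  ultimately have "provable U (subst (subst s'' \<kappa>) \<tau>) (const eT)"
    by (simp add: \<kappa>_def)
  then have eqU: "provable U (subst s'' \<kappa>) (const eT)"
    by (intro composite_reflects_constant[OF comp T1 _ u, where \<tau> = \<tau>])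
      (rule T2, assumption+, auto simp: \<tau>_def S3_f)
  \<comment> \<open>\<open>\<sigma> y\<close> may itself contain \<open>x\<close>, and in
    \<open>subst s' \<kappa>\<close> these occurrences become \<open>eT\<close> too.\<close>
  define \<rho> where "\<rho> y = (if y \<in> I then subst (\<sigma> y) \<kappa> else Var y)" for y
  have "term_of U (\<rho> y)" for y
    using S3_decomp(2) \<kappa> by (auto simp: \<rho>_def intro: term_of_subst term_of_contains[OF cS])
  from provable_subst[OF eqU this]
  have "provable U (subst (subst s'' \<kappa>) \<rho>) (const eT)"
    by simp
  moreover have "subst (subst s'' \<kappa>) \<rho> = subst s' \<kappa>"
    using x(2)
    by (auto simp: S3_decomp(3) subst_on_def subst_subst \<rho>_def \<kappa>_def intro!: subst_cong)
  moreover have "provable U (subst s' \<kappa>) (const eS)"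
    using provable_subst[OF provable_contains[OF cS], of s' "const eS" \<kappa>] S3_eq(1) \<kappa>
    by (simp add: provable_in_def)
  ultimately have "provable U (const eS) (const eT)"
    by (metis provable.sym provable.trans)
  with composite_constants_distinct[OF comp inf_vars consistent(2) S1 T1] show False
    by blast
qed

end
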